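(* Let $\mathcal{A}\in T_{m,n}$ be a semi-symmetric tensor, $q\in\mathbb{R}^n$, $p\in(0,1)$, $t>0$, and let $S_p^*$ be the set of local minimizers of $$\min_{u\in\mathbb{R}^n} f(u)=\tfrac12\|\Phi_{FB}(u)\|^2+t\|u\|_p^p .$$ Let $\mu$ be an upper bound of $S_p^*$, i.e. $\|u\|\le\mu$ for all $u\in S_p^*$. Let $u^*$ be a local minimizer of this problem satisfying $f(u^* )\le f(u_0)$ for an initial point $u_0\in\mathbb{R}^n$. Denote $$\gamma(k)=k^{p-1}\left(\frac{2\sqrt2\,\bigl(1+(m-1)\|\mathcal{A}\|\mu^{m-2}\bigr)}{p}\right)^{p}\left(\sqrt{f(u_0)}\right)^{2-p},\qquad k\in\{1,\ldots,n\}.$$ Then the following hold: (a) For $k\in\{1,\ldots,n\}$, if $t\ge\gamma(k)$, then $\|u^*\|_0<k$. (b) For $k=1$, if $t\ge\gamma(1)$, then $u^*=0$ is the unique minimizer of the problem.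
   Context: $T_{m,n}$ is the set of real tensors $\mathcal{A}=(a_{i_1\ldots i_m})$ of order $m\ge 2$ and dimension $n$. $\mathcal{A}$ is semi-symmetric if for each $i$ the entries $a_{i i_2\ldots i_m}$ are invariant under all permutations of $i_2,\ldots,i_m$. For $u\in\mathbb{R}^n$, $\mathcal{A}u^{m-1}\in\mathbb{R}^n$ is the vector with $(\mathcal{A}u^{m-1})_i=\sum_{i_2,\ldots,i_m=1}^n a_{i i_2\ldots i_m}u_{i_2}\cdots u_{i_m}$. $\|\mathcal{A}\|=\bigl(\sum_{i_1,\ldots,i_m}a_{i_1\ldots i_m}^2\bigr)^{1/2}$ is the Frobenius norm. The Fischer-Burmeister function is $\phi_{FB}(a,b)=\sqrt{a^2+b^2}-(a+b)$ for $a,b\in\mathbb{R}$, and $\Phi_{FB}:\mathbb{R}^n\to\mathbb{R}^n$ is defined by $\Phi_{FB}(u)_i=\phi_{FB}(u_i,(q+\mathcal{A}u^{m-1})_i)$, $i=1,\ldots,n$. On vectors, $\|\cdot\|$ is the Euclidean norm, $\|u\|_p^p=\sum_{i=1}^n|u_i|^p$, and $\|u\|_0$ is the number of nonzero components of $u$. *)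

theory Defs
  imports "HOL-Analysis.Analysis" "HOL-Combinatorics.Permutations"
begin

text \<open>
  Vectors of dimension \<open>n\<close> have type \<open>real ^ 'n\<close> with \<open>n = CARD('n)\<close>. A tensor of order \<open>m\<close> and
  dimension \<open>n\<close> is given by its entries, indexed by the lists over \<open>'n\<close> of length \<open>m\<close>: the entry
  \<open>a\<close> at \<open>(i\<^sub>1, \<dots>, i\<^sub>m)\<close> is \<open>A [i\<^sub>1, \<dots>, i\<^sub>m]\<close>. The values of \<open>A\<close> at lists of any other length are
  irrelevant: every definition takes \<open>m\<close> as an argument and only uses lists of length \<open>m\<close>.
\<close>

type_synonym 'n tensor = "'n list \<Rightarrow> real"

definition semi_symmetric :: "nat \<Rightarrow> 'n tensor \<Rightarrow> bool" where
  "semi_symmetric m A \<longleftrightarrow>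
     (\<forall>i js \<pi>. length js = m - 1 \<and> \<pi> permutes {..<m - 1} \<longrightarrow>
        A (i # permute_list \<pi> js) = A (i # js))"

definition tensor_apply :: "nat \<Rightarrow> 'n::finite tensor \<Rightarrow> real ^ 'n \<Rightarrow> real ^ 'n" where
  "tensor_apply m A u =
     (\<chi> i. \<Sum>js \<in> {js. length js = m - 1}. A (i # js) * (\<Prod>j\<leftarrow>js. u $ j))"

definition frobenius_norm :: "nat \<Rightarrow> 'n::finite tensor \<Rightarrow> real" where
  "frobenius_norm m A = sqrt (\<Sum>is \<in> {is. length is = m}. (A is)\<^sup>2)"

definition phi_FB :: "real \<Rightarrow> real \<Rightarrow> real" where
  "phi_FB a b = sqrt (a\<^sup>2 + b\<^sup>2) - (a + b)"

definition Phi_FB :: "nat \<Rightarrow> 'n::finite tensor \<Rightarrow> real ^ 'n \<Rightarrow> real ^ 'n \<Rightarrow> real ^ 'n" where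
  "Phi_FB m A q u = (\<chi> i. phi_FB (u $ i) ((q + tensor_apply m A u) $ i))"

text \<open>The \<open>p\<close>-th power of the \<open>p\<close>-(quasi)norm; note \<open>0 powr p = 0\<close>.\<close>

definition lp_pow :: "real \<Rightarrow> real ^ 'n::finite \<Rightarrow> real" where
  "lp_pow p u = (\<Sum>i\<in>UNIV. \<bar>u $ i\<bar> powr p)"

definition l0_norm :: "real ^ 'n::finite \<Rightarrow> nat" where
  "l0_norm u = card {i. u $ i \<noteq> 0}"

definition objective ::
  "nat \<Rightarrow> 'n::finite tensor \<Rightarrow> real ^ 'n \<Rightarrow> real \<Rightarrow> real \<Rightarrow> real ^ 'n \<Rightarrow> real" where
  "objective m A q p t u = 1/2 * (norm (Phi_FB m A q u))\<^sup>2 + t * lp_pow p u"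

definition local_minimizers :: "('a::metric_space \<Rightarrow> real) \<Rightarrow> 'a set" where
  "local_minimizers f = {u. \<exists>\<epsilon>>0. \<forall>v\<in>ball u \<epsilon>. f u \<le> f v}"

definition global_minimizers :: "('a \<Rightarrow> real) \<Rightarrow> 'a set" where
  "global_minimizers f = {u. \<forall>v. f u \<le> f v}"

text \<open>The threshold \<open>\<gamma>(k)\<close>; the argument \<open>f0\<close> is the objective value \<open>f(u\<^sub>0)\<close>.\<close>

definition threshold ::
  "nat \<Rightarrow> 'n::finite tensor \<Rightarrow> real \<Rightarrow> real \<Rightarrow> real \<Rightarrow> nat \<Rightarrow> real" where
  "threshold m A p \<mu> f0 k =
     real k powr (p - 1)
     * (2 * sqrt 2 * (1 + (real m - 1) * frobenius_norm m A * \<mu> ^ (m - 2)) / p) powr p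
     * sqrt f0 powr (2 - p)"

end

theory Submission imports Defs begin

text \<open>
  The heart of the proof is a lower bound for the nonzero entries of a local minimizer \<open>u\<close>.
  Shrink one nonzero entry, of absolute value \<open>x\<close>, by a small \<open>h\<close>. By concavity of
  \<open>z \<mapsto> z powr p\<close> the regularizer drops by at least \<open>t * p * x powr (p - 1) * h\<close>. The map \<open>Phi_FB\<close>
  is Lipschitz on the ball of radius \<open>\<mu>\<close> with constant \<open>2 * L\<close>, where
  \<open>L = 1 + (m - 1) * \<parallel>A\<parallel> * \<mu> ^ (m - 2)\<close>, so the residual term grows by at most
  \<open>2 * L * \<parallel>Phi_FB u\<parallel> * h + O(h\<^sup>2)\<close>. Local minimality therefore forces
  \<open>t * p * x powr (p - 1) \<le> 2 * L * \<parallel>Phi_FB u\<parallel>\<close>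
  (lemma \<open>nonzero_entry_of_local_minimizer\<close>). Since \<open>p < 1\<close>, the entry cannot be small.

  The argument compares function values instead of setting a gradient to zero, so the points
  where \<open>phi_FB\<close> is not differentiable need no separate treatment. A shrinking step does not
  increase the norm, hence stays in the ball of radius \<open>\<mu>\<close>, where the Lipschitz bound of the
  polynomial map \<open>tensor_apply\<close> comes from telescoping tensor powers.

  If \<open>k\<close> entries are nonzero and \<open>x\<close> is the smallest of them in absolute value, then also
  \<open>t * k * x powr p \<le> f u \<le> f u\<^sub>0\<close>. Eliminating \<open>x\<close> from the two inequalities gives
  \<open>t < \<gamma> k\<close> (lemma \<open>regularization_lt_of_entry_bounds\<close>), which is the contrapositive of the
  first claim. The inequality is strict because the regularizer takes a positive share of
  \<open>f u\<close>, so that \<open>\<parallel>Phi_FB u\<parallel>\<^sup>2 < 2 * f u\<close>.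

  For \<open>t \<ge> \<gamma> 1\<close> every local minimizer with value at most \<open>f u\<^sub>0\<close>, hence every global one, is zero.
  A global minimizer exists since the objective is continuous and its sublevel sets are bounded.
\<close>

section \<open>Tensor powers and the Lipschitz constant of the tensor map\<close>

lemma finite_lists_of_length: "finite {js :: 'n::finite list. length js = k}"
  using finite_lists_length_eq[of "UNIV :: 'n set" k] by simp

lemma sum_lists_Suc:
  fixes f :: "'n::finite list \<Rightarrow> 'b::comm_monoid_add"
  shows "(\<Sum>js \<in> {js. length js = Suc k}. f js)
       = (\<Sum>i\<in>UNIV. \<Sum>js \<in> {js. length js = k}. f (i # js))"
proof -
  have eq: "{js :: 'n list. length js = Suc k}
      = (\<lambda>(i, js). i # js) ` (UNIV \<times> {js. length js = k})"
    by (auto simp: length_Suc_conv image_iff)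
  have "(\<Sum>js \<in> {js. length js = Suc k}. f js)
      = (\<Sum>x \<in> UNIV \<times> {js. length js = k}. f ((\<lambda>(i, js). i # js) x))"
    unfolding eq by (subst sum.reindex) (auto simp: inj_on_def o_def)
  also have "\<dots> = (\<Sum>(i, js) \<in> UNIV \<times> {js. length js = k}. f (i # js))"
    by (intro sum.cong) auto
  also have "\<dots> = (\<Sum>i\<in>UNIV. \<Sum>js \<in> {js. length js = k}. f (i # js))"
    by (rule sum.cartesian_product[symmetric])
  finally show ?thesis .
qed

lemma L2_set_outer_product:
  fixes a :: "'n::finite \<Rightarrow> real"
  shows "L2_set (\<lambda>js. a (hd js) * b (tl js)) {js. length js = Suc k}
       = L2_set a UNIV * L2_set b {js. length js = k}"
  by (simp add: L2_set_def sum_lists_Suc power_mult_distrib sum_product real_sqrt_mult[symmetric])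

lemma norm_eq_L2_set: "norm (u :: real ^ 'n) = L2_set (\<lambda>i. u $ i) UNIV"
  by (simp add: norm_vec_def L2_set_def)

lemma L2_set_tensor_power:
  fixes u :: "real ^ 'n"
  shows "L2_set (\<lambda>js. \<Prod>j\<leftarrow>js. u $ j) {js. length js = k} = norm u ^ k"
proof (induction k)
  case 0
  then show ?case by (simp add: L2_set_def)
next
  case (Suc k)
  have "L2_set (\<lambda>js. \<Prod>j\<leftarrow>js. u $ j) {js. length js = Suc k}
      = L2_set (\<lambda>js. u $ hd js * (\<Prod>j\<leftarrow>tl js. u $ j)) {js. length js = Suc k}"
    by (rule L2_set_cong) (auto simp: length_Suc_conv)
  then show ?case
    by (simp add: L2_set_outer_product[where b = "\<lambda>js. \<Prod>j\<leftarrow>js. u $ j"] Suc norm_eq_L2_set)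
qed

text \<open>
  Telescoping: \<open>v\<^bsup>\<otimes>k+1\<^esup> - u\<^bsup>\<otimes>k+1\<^esup> = (v - u) \<otimes> v\<^bsup>\<otimes>k\<^esup> + u \<otimes> (v\<^bsup>\<otimes>k\<^esup> - u\<^bsup>\<otimes>k\<^esup>)\<close>. At \<open>k = 0\<close> the truncated
  exponent \<open>k - 1\<close> is harmless because of the factor \<open>k\<close>.
\<close>

lemma L2_set_tensor_power_diff:
  fixes u v :: "real ^ 'n"
  assumes "norm u \<le> R" "norm v \<le> R"
  shows "L2_set (\<lambda>js. (\<Prod>j\<leftarrow>js. v $ j) - (\<Prod>j\<leftarrow>js. u $ j)) {js. length js = k}
       \<le> real k * R ^ (k - 1) * norm (v - u)"
proof (induction k)
  case 0
  then show ?case by (simp add: L2_set_def)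
next
  case (Suc k)
  let ?P = "\<lambda>(w :: real ^ 'n) js. \<Prod>j\<leftarrow>js. w $ j"
  let ?D = "\<lambda>js. ?P v js - ?P u js"
  let ?S = "\<lambda>k. {js :: 'n list. length js = k}"
  have R: "0 \<le> R" using assms(1) norm_ge_zero[of u] by linarith
  have "L2_set ?D (?S (Suc k))
      = L2_set (\<lambda>js. (v - u) $ hd js * ?P v (tl js) + u $ hd js * ?D (tl js)) (?S (Suc k))"
    by (rule L2_set_cong) (auto simp: length_Suc_conv algebra_simps)
  also have "\<dots> \<le> L2_set (\<lambda>js. (v - u) $ hd js * ?P v (tl js)) (?S (Suc k))
      + L2_set (\<lambda>js. u $ hd js * ?D (tl js)) (?S (Suc k))"
    by (rule L2_set_triangle_ineq)
  also have "\<dots> = norm (v - u) * norm v ^ k + norm u * L2_set ?D (?S k)"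
    using L2_set_outer_product[of "\<lambda>i. (v - u) $ i" "?P v" k]
      L2_set_outer_product[of "\<lambda>i. u $ i" ?D k]
    by (simp add: L2_set_tensor_power norm_eq_L2_set)
  also have "\<dots> \<le> norm (v - u) * R ^ k + R * (real k * R ^ (k - 1) * norm (v - u))"
    using assms R Suc by (intro add_mono mult_mono power_mono) (auto simp: L2_set_nonneg)
  also have "\<dots> = real (Suc k) * R ^ (Suc k - 1) * norm (v - u)"
    by (cases k) (auto simp: algebra_simps)
  finally show ?case .
qed

text \<open>
  Cauchy--Schwarz in each component moves the tensor out as its Frobenius norm and leaves the
  norm of the difference of two tensor powers.
\<close>

lemma tensor_apply_lipschitz:
  fixes u v :: "real ^ 'n"
  assumes "m \<ge> 2" "norm u \<le> R" "norm v \<le> R"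
  shows "norm (tensor_apply m A v - tensor_apply m A u)
       \<le> (real m - 1) * frobenius_norm m A * R ^ (m - 2) * norm (v - u)"
proof -
  obtain k where k: "m = Suc (Suc k)"
    using assms(1) by (metis add_2_eq_Suc le_Suc_ex)
  define S where "S = {js :: 'n list. length js = Suc k}"
  define D where "D = (\<lambda>js. (\<Prod>j\<leftarrow>js. v $ j) - (\<Prod>j\<leftarrow>js. u $ j))"
  have comp: "\<bar>(tensor_apply m A v - tensor_apply m A u) $ i\<bar>
      \<le> L2_set (\<lambda>js. A (i # js)) S * L2_set D S" for i
  proof -
    have "(tensor_apply m A v - tensor_apply m A u) $ i = (\<Sum>js\<in>S. A (i # js) * D js)"
      by (simp add: tensor_apply_def k S_def D_def sum_subtractf right_diff_distrib)
    also have "\<bar>\<dots>\<bar> \<le> (\<Sum>js\<in>S. \<bar>A (i # js)\<bar> * \<bar>D js\<bar>)"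
      by (rule order_trans[OF sum_abs]) (simp add: abs_mult)
    also have "\<dots> \<le> L2_set (\<lambda>js. A (i # js)) S * L2_set D S"
      by (rule L2_set_mult_ineq)
    finally show ?thesis .
  qed
  have "norm (tensor_apply m A v - tensor_apply m A u)
      \<le> L2_set (\<lambda>i. L2_set (\<lambda>js. A (i # js)) S * L2_set D S) UNIV"
    unfolding norm_vec_def by (rule L2_set_mono) (use comp in auto)
  also have "\<dots> = L2_set (\<lambda>i. L2_set (\<lambda>js. A (i # js)) S) UNIV * L2_set D S"
    by (rule L2_set_left_distrib[symmetric]) (simp add: L2_set_nonneg)
  also have "L2_set (\<lambda>i. L2_set (\<lambda>js. A (i # js)) S) UNIV = frobenius_norm m A"
    by (simp add: L2_set_def frobenius_norm_def k S_def sum_lists_Suc[of _ "Suc k"] sum_nonneg)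
  finally have "norm (tensor_apply m A v - tensor_apply m A u) \<le> frobenius_norm m A * L2_set D S" .
  also have "\<dots> \<le> frobenius_norm m A * (real (Suc k) * R ^ k * norm (v - u))"
    using L2_set_tensor_power_diff[OF assms(2,3), of "Suc k"]
    by (intro mult_left_mono) (auto simp: D_def S_def frobenius_norm_def sum_nonneg)
  finally show ?thesis by (simp add: k mult_ac)
qed

section \<open>The Fischer--Burmeister map\<close>

lemma phi_FB_lipschitz:
  "\<bar>phi_FB a' b' - phi_FB a b\<bar> \<le> 2 * \<bar>a' - a\<bar> + 2 * \<bar>b' - b\<bar>"
proof -
  have "\<bar>sqrt (a'\<^sup>2 + b'\<^sup>2) - sqrt (a\<^sup>2 + b\<^sup>2)\<bar> \<le> norm ((a', b') - (a, b))"
    using norm_triangle_ineq3[of "(a', b')" "(a, b)"] by (simp add: norm_Pair)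
  also have "\<dots> \<le> \<bar>a' - a\<bar> + \<bar>b' - b\<bar>"
    using sqrt_sum_squares_le_sum_abs[of "a' - a" "b' - b"] by (simp add: norm_Pair)
  finally show ?thesis unfolding phi_FB_def abs_le_iff by (smt (verit))
qed

lemma Phi_FB_lipschitz:
  fixes u v :: "real ^ 'n"
  assumes "m \<ge> 2" "norm u \<le> R" "norm v \<le> R"
  shows "norm (Phi_FB m A q v - Phi_FB m A q u)
       \<le> 2 * (1 + (real m - 1) * frobenius_norm m A * R ^ (m - 2)) * norm (v - u)"
proof -
  let ?F = "tensor_apply m A"
  have "norm (Phi_FB m A q v - Phi_FB m A q u)
      \<le> L2_set (\<lambda>i. 2 * \<bar>(v - u) $ i\<bar> + 2 * \<bar>(?F v - ?F u) $ i\<bar>) UNIV"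
    unfolding norm_vec_def
  proof (rule L2_set_mono)
    fix i
    show "norm ((Phi_FB m A q v - Phi_FB m A q u) $ i)
        \<le> 2 * \<bar>(v - u) $ i\<bar> + 2 * \<bar>(?F v - ?F u) $ i\<bar>"
      using phi_FB_lipschitz[of "v $ i" "(q + ?F v) $ i" "u $ i" "(q + ?F u) $ i"]
      by (simp add: Phi_FB_def)
  qed simp
  also have "\<dots> \<le> L2_set (\<lambda>i. 2 * \<bar>(v - u) $ i\<bar>) UNIV + L2_set (\<lambda>i. 2 * \<bar>(?F v - ?F u) $ i\<bar>) UNIV"
    by (rule L2_set_triangle_ineq)
  also have "\<dots> = 2 * norm (v - u) + 2 * norm (?F v - ?F u)"
    unfolding norm_vec_def real_norm_def by (simp add: L2_set_right_distrib)
  also have "\<dots> \<le> 2 * norm (v - u)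
      + 2 * ((real m - 1) * frobenius_norm m A * R ^ (m - 2) * norm (v - u))"
    using tensor_apply_lipschitz[OF assms, of A] by simp
  finally show ?thesis by (simp add: algebra_simps)
qed

section \<open>Nonzero entries of a local minimizer\<close>

text \<open>The graph of the concave function \<open>z \<mapsto> z powr p\<close> lies below its tangent at \<open>x\<close>.\<close>

lemma powr_diff_ge_tangent:
  fixes x h p :: real
  assumes "0 < p" "p < 1" "0 < h" "h < x"
  shows "p * x powr (p - 1) * h \<le> x powr p - (x - h) powr p"
proof -
  have "\<exists>z. x - h < z \<and> z < x \<and> x powr p - (x - h) powr p = (x - (x - h)) * (p * z powr (p - 1))"
    using assms by (intro MVT2) (auto intro!: derivative_eq_intros)
  then obtain z where z: "x - h < z" "z < x" "x powr p - (x - h) powr p = h * (p * z powr (p - 1))"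
    by auto
  have "x powr (p - 1) \<le> z powr (p - 1)"
    using z assms by (intro powr_mono2') auto
  then show ?thesis using z assms by (simp add: mult_ac mult_left_mono)
qed

lemma lp_pow_remove:
  "lp_pow p u = \<bar>u $ i\<bar> powr p + (\<Sum>j\<in>UNIV - {i}. \<bar>u $ j\<bar> powr p)"
  unfolding lp_pow_def by (subst sum.remove[of _ i]) auto

text \<open>
  A first-order condition without derivatives of \<open>Phi_FB\<close>: the gain and the loss of a shrinking
  step of length \<open>h\<close> are compared, divided by \<open>h\<close>, and \<open>h\<close> tends to zero.
\<close>

lemma nonzero_entry_of_local_minimizer:
  fixes u :: "real ^ 'n"
  assumes "m \<ge> 2" "0 < p" "p < 1" "t > 0"
    and min: "u \<in> local_minimizers (objective m A q p t)"
    and R: "norm u \<le> R" and nz: "u $ i \<noteq> 0"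
  shows "t * p * \<bar>u $ i\<bar> powr (p - 1)
       \<le> 2 * (1 + (real m - 1) * frobenius_norm m A * R ^ (m - 2)) * norm (Phi_FB m A q u)"
    (is "?lhs \<le> 2 * ?L * ?N")
proof -
  obtain \<epsilon> where e: "\<epsilon> > 0" "\<And>v. v \<in> ball u \<epsilon> \<Longrightarrow> objective m A q p t u \<le> objective m A q p t v"
    using min unfolding local_minimizers_def by auto
  define x where "x = \<bar>u $ i\<bar>"
  have x: "x > 0" using nz by (simp add: x_def)
  have step: "?lhs \<le> 2 * ?L * ?N + 2 * ?L\<^sup>2 * h" if h: "0 < h" "h < \<epsilon>" "h < x" for h
  proof -
    \<comment> \<open>A step towards zero keeps \<open>norm v \<le> norm u \<le> R\<close>, where the Lipschitz constant is valid.\<close>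
    define v where "v = u - axis i (sgn (u $ i) * h)"
    have vi: "\<bar>v $ i\<bar> = x - h"
      using h x unfolding v_def x_def by (auto simp: axis_def sgn_if abs_if)
    have vj: "v $ j = u $ j" if "j \<noteq> i" for j
      using that by (simp add: v_def axis_def)
    have dist: "norm (v - u) = h"
      using h nz by (simp add: v_def norm_eq_sqrt_inner inner_axis_axis abs_mult abs_sgn_eq)
    have "\<bar>v $ j\<bar> \<le> \<bar>u $ j\<bar>" for j
      using vi vj[of j] h by (cases "j = i") (auto simp: x_def)
    then have "norm v \<le> norm u" by (intro norm_le_componentwise_cart) simp
    then have Rv: "norm v \<le> R" using R by simp
    let ?Nv = "norm (Phi_FB m A q v)"
    have lip: "norm (Phi_FB m A q v - Phi_FB m A q u) \<le> 2 * ?L * h"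
      using Phi_FB_lipschitz[OF assms(1) R Rv, of A q] dist by simp
    have "?Nv \<le> ?N + 2 * ?L * h"
      using lip norm_triangle_ineq2[of "Phi_FB m A q v" "Phi_FB m A q u"] by linarith
    then have "?Nv\<^sup>2 \<le> (?N + 2 * ?L * h)\<^sup>2"
      by (intro power_mono) auto
    then have sq: "1/2 * ?Nv\<^sup>2 - 1/2 * ?N\<^sup>2 \<le> (2 * ?L * ?N + 2 * ?L\<^sup>2 * h) * h"
      by (simp add: power2_eq_square algebra_simps)
    have "(\<Sum>j\<in>UNIV - {i}. \<bar>v $ j\<bar> powr p) = (\<Sum>j\<in>UNIV - {i}. \<bar>u $ j\<bar> powr p)"
      using vj by (intro sum.cong) auto
    then have lp: "lp_pow p u - lp_pow p v = x powr p - (x - h) powr p"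
      by (simp add: lp_pow_remove[of p _ i] vi x_def)
    have "objective m A q p t u \<le> objective m A q p t v"
      using dist h by (intro e(2)) (simp add: dist_norm norm_minus_commute)
    then have "t * (lp_pow p u - lp_pow p v) \<le> 1/2 * ?Nv\<^sup>2 - 1/2 * ?N\<^sup>2"
      unfolding objective_def by (simp add: algebra_simps)
    moreover have "t * (p * x powr (p - 1) * h) \<le> t * (lp_pow p u - lp_pow p v)"
      unfolding lp using powr_diff_ge_tangent[OF assms(2,3) h(1,3)] assms(4)
      by (intro mult_left_mono) auto
    ultimately have "?lhs * h \<le> (2 * ?L * ?N + 2 * ?L\<^sup>2 * h) * h"
      using sq by (simp add: x_def mult_ac)
    then show ?thesis using h by (simp add: mult_le_cancel_right)
  qed
  have "((\<lambda>h. 2 * ?L * ?N + 2 * ?L\<^sup>2 * h) \<longlongrightarrow> 2 * ?L * ?N + 2 * ?L\<^sup>2 * 0) (at_right 0)"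
    by (intro tendsto_intros)
  moreover have "\<forall>\<^sub>F h in at_right 0. ?lhs \<le> 2 * ?L * ?N + 2 * ?L\<^sup>2 * h"
    using e(1) x step
    by (auto simp: eventually_at_right_field intro!: exI[of _ "min \<epsilon> x"])
  ultimately have "?lhs \<le> 2 * ?L * ?N + 2 * ?L\<^sup>2 * 0"
    by (intro tendsto_lowerbound) auto
  then show ?thesis by simp
qed

section \<open>Sparsity\<close>

text \<open>
  Elimination of the entry \<open>x\<close>: raise the first bound to the power \<open>p\<close>, the second to the power
  \<open>1 - p\<close>, and multiply, so that the powers of \<open>x\<close> cancel and those of \<open>t\<close> combine to \<open>t\<close>.
  With \<open>f = s\<^sup>2\<close> the exponents of \<open>s\<close> add up to \<open>p + 2 * (1 - p) = 2 - p\<close>.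
\<close>

lemma regularization_lt_of_entry_bounds:
  fixes t p x s C k :: real
  assumes "0 < p" "p < 1" "t > 0" "x > 0" "s > 0" "C > 0" "k > 0"
    and 1: "t * p * x powr (p - 1) < C * s"
    and 2: "t * k * x powr p \<le> s\<^sup>2"
  shows "t < k powr (p - 1) * (C / p) powr p * s powr (2 - p)"
proof -
  have tx: "t * x powr (p - 1) < C / p * s"
    using 1 assms(1) by (simp add: field_simps)
  have A: "(t * x powr (p - 1)) powr p < (C / p * s) powr p"
    using tx assms by (intro powr_less_mono2) auto
  have "(t * k * x powr p) powr (1 - p) \<le> (s\<^sup>2) powr (1 - p)"
    using 2 assms by (intro powr_mono2) auto
  with A have "(t * x powr (p - 1)) powr p * (t * k * x powr p) powr (1 - p)
      < (C / p * s) powr p * (s\<^sup>2) powr (1 - p)"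
    using assms by (intro mult_less_le_imp_less) auto
  also have "(t * x powr (p - 1)) powr p * (t * k * x powr p) powr (1 - p)
      = (t powr p * t powr (1 - p)) * k powr (1 - p)
        * (x powr ((p - 1) * p) * x powr (p * (1 - p)))"
    using assms by (simp add: powr_mult powr_powr mult_ac)
  also have "\<dots> = t * k powr (1 - p)"
    using assms by (simp add: powr_add[symmetric] algebra_simps)
  also have "(C / p * s) powr p * (s\<^sup>2) powr (1 - p)
      = (C / p) powr p * (s powr p * s powr (2 * (1 - p)))"
    using assms powr_powr[of s 2 "1 - p"] powr_mult[of "C / p" s p] by simp
  also have "\<dots> = (C / p) powr p * s powr (2 - p)"
    by (simp add: powr_add[symmetric])
  finally have "t * k powr (1 - p) < (C / p) powr p * s powr (2 - p)" .
  then have "t * k powr (1 - p) * k powr (p - 1)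
      < (C / p) powr p * s powr (2 - p) * k powr (p - 1)"
    using assms by (intro mult_strict_right_mono) auto
  moreover have "k powr (1 - p) * k powr (p - 1) = 1"
    using assms by (simp add: powr_add[symmetric])
  ultimately show ?thesis by (simp add: mult_ac)
qed

text \<open>
  The smallest nonzero entry in absolute value serves both bounds: the first-order condition holds
  at every nonzero entry, and the minimal one bounds the regularizer from below by \<open>k\<close> equal terms.
\<close>

lemma l0_norm_lt_of_local_minimizer:
  fixes u :: "real ^ 'n" and A :: "'n::finite tensor"
  assumes "m \<ge> 2" "0 < p" "p < 1" "t > 0"
    and min: "u \<in> local_minimizers (objective m A q p t)"
    and mu: "norm u \<le> \<mu>" and f: "objective m A q p t u \<le> f0"
    and k: "k \<ge> 1" and t: "t \<ge> threshold m A p \<mu> f0 k"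
  shows "l0_norm u < k"
proof (rule ccontr)
  assume "\<not> l0_norm u < k"
  then have card: "k \<le> card {i. u $ i \<noteq> 0}" by (simp add: l0_norm_def)
  define S where "S = {i. u $ i \<noteq> 0}"
  have "S \<noteq> {}" using card k unfolding S_def by (intro notI) simp
  define i where "i = arg_min_on (\<lambda>i. \<bar>u $ i\<bar>) S"
  have i: "i \<in> S" and least: "\<And>j. j \<in> S \<Longrightarrow> \<bar>u $ i\<bar> \<le> \<bar>u $ j\<bar>"
    using arg_min_if_finite(1)[of S "\<lambda>i. \<bar>u $ i\<bar>"] arg_min_least[of S _ "\<lambda>i. \<bar>u $ i\<bar>"] \<open>S \<noteq> {}\<close>
    by (auto simp: i_def)
  define x where "x = \<bar>u $ i\<bar>"
  have x: "x > 0" using i by (simp add: S_def x_def)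
  define L where "L = 1 + (real m - 1) * frobenius_norm m A * \<mu> ^ (m - 2)"
  have "\<mu> \<ge> 0" using mu norm_ge_zero[of u] by linarith
  then have L: "L > 0"
    using assms(1) by (auto simp: L_def frobenius_norm_def sum_nonneg intro!: add_pos_nonneg)
  let ?N = "norm (Phi_FB m A q u)"
  have "real k * x powr p \<le> (\<Sum>j\<in>S. x powr p)"
    using card by (simp add: S_def mult_right_mono)
  also have "\<dots> \<le> (\<Sum>j\<in>S. \<bar>u $ j\<bar> powr p)"
    using least assms(2) by (intro sum_mono powr_mono2) (auto simp: x_def)
  also have "\<dots> \<le> lp_pow p u"
    unfolding lp_pow_def by (intro sum_mono2) auto
  finally have kx: "real k * x powr p \<le> lp_pow p u" .
  then have tkx: "t * real k * x powr p \<le> t * lp_pow p u"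
    using assms(4) by (simp add: mult.assoc)
  moreover have pos: "0 < t * real k * x powr p"
    using assms(4) k x by simp
  ultimately have N: "?N\<^sup>2 < 2 * f0" and tk: "t * real k * x powr p \<le> f0"
    using f zero_le_power2[of ?N] unfolding objective_def by linarith+
  have f0: "f0 > 0" using tk pos by linarith
  have "?N < sqrt 2 * sqrt f0"
    using real_less_rsqrt[OF N] by (simp add: real_sqrt_mult)
  moreover have "t * p * x powr (p - 1) \<le> 2 * L * ?N"
    using nonzero_entry_of_local_minimizer[OF assms(1-4) min mu, of i] i
    by (simp add: S_def x_def L_def)
  moreover have "2 * L * ?N < 2 * L * (sqrt 2 * sqrt f0)"
    using calculation(1) L by (intro mult_strict_left_mono) auto
  ultimately have "t * p * x powr (p - 1) < (2 * sqrt 2 * L) * sqrt f0"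
    by (simp add: mult_ac)
  then have "t < real k powr (p - 1) * (2 * sqrt 2 * L / p) powr p * sqrt f0 powr (2 - p)"
    using assms(2-4) x f0 L k tk
    by (intro regularization_lt_of_entry_bounds[where x = x]) auto
  then show False
    using t by (simp add: threshold_def L_def)
qed

section \<open>Existence of a global minimizer\<close>

lemma continuous_on_objective:
  fixes A :: "'n::finite tensor"
  assumes "0 < p"
  shows "continuous_on UNIV (objective m A q p t)"
proof -
  have "continuous_on UNIV (\<lambda>u :: real ^ 'n. \<Prod>j\<leftarrow>js. u $ j)" for js
    by (induction js) (auto intro!: continuous_intros)
  then have "continuous_on UNIV (\<lambda>u :: real ^ 'n. tensor_apply m A u)"
    unfolding tensor_apply_def by (auto intro!: continuous_intros continuous_on_vec_lambda)
  then have "continuous_on UNIV (Phi_FB m A q)"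
    unfolding Phi_FB_def phi_FB_def
    by (auto intro!: continuous_intros continuous_on_vec_lambda)
  moreover have "continuous_on UNIV (lp_pow p)"
    unfolding lp_pow_def using assms
    by (auto intro!: continuous_intros continuous_on_powr')
  ultimately show ?thesis
    unfolding objective_def by (auto intro!: continuous_intros)
qed

lemma bounded_objective_sublevel:
  fixes A :: "'n::finite tensor"
  assumes "0 < p" "t > 0"
  shows "bounded {u :: real ^ 'n. objective m A q p t u \<le> c}"
proof (rule boundedI)
  fix u assume "u \<in> {u. objective m A q p t u \<le> c}"
  then have c: "t * lp_pow p u \<le> c"
    using zero_le_power2[of "norm (Phi_FB m A q u)"]
    unfolding objective_def mem_Collect_eq by linarith
  have "\<bar>u $ i\<bar> \<le> (c / t) powr (1 / p)" for i
  proof -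
    have "\<bar>u $ i\<bar> powr p \<le> lp_pow p u"
      by (subst lp_pow_remove[of _ _ i]) (simp add: sum_nonneg)
    also have "\<dots> \<le> c / t" using c assms(2) by (simp add: field_simps)
    finally have "(\<bar>u $ i\<bar> powr p) powr (1 / p) \<le> (c / t) powr (1 / p)"
      using assms(1) by (intro powr_mono2) auto
    then show ?thesis using assms(1) by (simp add: powr_powr)
  qed
  then have "(\<Sum>i\<in>UNIV. \<bar>u $ i\<bar>) \<le> (\<Sum>i\<in>(UNIV :: 'n set). (c / t) powr (1 / p))"
    by (intro sum_mono)
  then show "norm u \<le> (\<Sum>i\<in>(UNIV :: 'n set). (c / t) powr (1 / p))"
    using norm_le_l1_cart[of u] by linarith
qed

lemma global_minimizer_exists:
  assumes "0 < p" "t > 0"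
  shows "global_minimizers (objective m A q p t) \<noteq> {}"
proof -
  let ?f = "objective m A q p t"
  define K where "K = {u. ?f u \<le> ?f 0}"
  have "closed K"
    unfolding K_def by (intro closed_Collect_le continuous_on_objective assms continuous_on_const)
  then have "compact K"
    using bounded_objective_sublevel[OF assms] by (simp add: compact_eq_bounded_closed K_def)
  moreover have "0 \<in> K" by (simp add: K_def)
  ultimately obtain u where u: "u \<in> K" "\<And>v. v \<in> K \<Longrightarrow> ?f u \<le> ?f v"
    using continuous_attains_inf[of K ?f] continuous_on_subset[OF continuous_on_objective[OF assms(1)]]
    by (metis empty_iff subset_UNIV)
  have "?f u \<le> ?f v" for v
    using u(2)[of v] u(1) by (cases "v \<in> K") (auto simp: K_def)
  then show ?thesis by (auto simp: global_minimizers_def)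
qed

lemma global_minimizers_subset_local_minimizers:
  "global_minimizers f \<subseteq> local_minimizers f"
  unfolding global_minimizers_def local_minimizers_def using zero_less_one by blast

lemma l0_norm_lt_1_iff: "l0_norm u < 1 \<longleftrightarrow> u = 0"
  by (auto simp: l0_norm_def vec_eq_iff)

section \<open>The sparsity threshold\<close>

theorem theorem3p9:
  fixes m :: nat and A :: "'n::finite tensor" and q u0 ustar :: "real ^ 'n"
    and p t \<mu> :: real
  assumes "m \<ge> 2"
    and "semi_symmetric m A"
    and "0 < p" and "p < 1"
    and "t > 0"
    and "\<forall>u \<in> local_minimizers (objective m A q p t). norm u \<le> \<mu>"
    and "ustar \<in> local_minimizers (objective m A q p t)"
    and "objective m A q p t ustar \<le> objective m A q p t u0"
  shows "(\<forall>k \<in> {1..CARD('n)}.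
            t \<ge> threshold m A p \<mu> (objective m A q p t u0) k \<longrightarrow> l0_norm ustar < k) \<and>
         (t \<ge> threshold m A p \<mu> (objective m A q p t u0) 1 \<longrightarrow>
            ustar = 0 \<and> global_minimizers (objective m A q p t) = {0})"
proof -
  let ?f = "objective m A q p t"
  have sparse: "l0_norm u < k"
    if "u \<in> local_minimizers ?f" "?f u \<le> ?f u0" "k \<ge> 1" "t \<ge> threshold m A p \<mu> (?f u0) k" for u k
    using l0_norm_lt_of_local_minimizer[OF assms(1,3,4,5) that(1)] that assms(6) by blast
  have "ustar = 0 \<and> global_minimizers ?f = {0}" if t: "t \<ge> threshold m A p \<mu> (?f u0) 1"
  proof
    have zero: "u = 0" if "u \<in> local_minimizers ?f" "?f u \<le> ?f u0" for u
      using sparse[OF that, of 1] t by (simp only: l0_norm_lt_1_iff order_refl)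
    then show "ustar = 0" using assms(7,8) by blast
    have "u = 0" if "u \<in> global_minimizers ?f" for u
    proof (rule zero)
      show "u \<in> local_minimizers ?f"
        using that global_minimizers_subset_local_minimizers by blast
      show "?f u \<le> ?f u0"
        using that by (simp add: global_minimizers_def)
    qed
    then show "global_minimizers ?f = {0}"
      using global_minimizer_exists[OF assms(3,5)] by blast
  qed
  then show ?thesis using sparse assms(7,8) by auto
qed

end
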